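(* Let $n\ge 1$ and $k\ge 2$ be integers and let $f,g$ be multisets on $\mathbb{Z}_2^n$. (1) If $f$ and $g$ are $k$-indistinguishable, then for every linear map $\theta:\mathbb{Z}_2^n\to\mathbb{Z}_2^p$ (any $p\ge 0$), the multisets $\theta f$ and $\theta g$ on $\mathbb{Z}_2^p$ are $k$-indistinguishable. (2) If $f$ and $g$ are $k$-distinguishable, then there exists a linear map $\theta:\mathbb{Z}_2^n\to\mathbb{Z}_2^{k-1}$ such that $\theta f$ and $\theta g$ are $k$-distinguishable.
   Context: A multiset on $\mathbb{Z}_2^m$ is a function $\phi:\mathbb{Z}_2^m\to\mathbb{N}$ (nonnegative integers). Its $i$-deck is the function $\mathrm{deck}_i\phi:(\mathbb{Z}_2^m)^i\to\mathbb{N}$, $\mathrm{deck}_i\phi(s_1,\dots,s_i)=\sum_{g\in\mathbb{Z}_2^m}\phi(g+s_1)\phi(g+s_2)\cdots\phi(g+s_i)$. Two multisets $\phi,\psi$ on $\mathbb{Z}_2^m$ are $k$-indistinguishable if $\mathrm{deck}_i\phi=\mathrm{deck}_i\psi$ for all $i\le k$, and $k$-distinguishable otherwise. For a linear map $\theta:\mathbb{Z}_2^n\to\mathbb{Z}_2^p$ and a multiset $f$ on $\mathbb{Z}_2^n$, $\theta f$ is the multiset on $\mathbb{Z}_2^p$ given by $\theta f(x)=\sum_{z:\theta z=x}f(z)$. *)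

theory Defs
  imports
    "HOL-Library.Z2"
    "Jordan_Normal_Form.VS_Connect"
begin

text \<open>
  \<open>\<int>\<^sub>2\<^sup>m\<close> is \<^term>\<open>carrier_vec m :: bit vec set\<close>; for \<open>m = 0\<close> it consists of the empty vector only.
  A multiset on \<open>\<int>\<^sub>2\<^sup>m\<close> is a function of type \<^typ>\<open>bit vec \<Rightarrow> nat\<close> of which only the values on
  \<^term>\<open>carrier_vec m\<close> are ever used, and a point of \<open>(\<int>\<^sub>2\<^sup>m)\<^sup>i\<close> is a list of length \<open>i\<close>.
\<close>

definition deck :: "nat \<Rightarrow> nat \<Rightarrow> (bit vec \<Rightarrow> nat) \<Rightarrow> bit vec list \<Rightarrow> nat" where
  "deck m i \<phi> s = (\<Sum>g\<in>carrier_vec m. \<Prod>j<i. \<phi> (g + s ! j))"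

definition indistinguishable ::
    "nat \<Rightarrow> nat \<Rightarrow> (bit vec \<Rightarrow> nat) \<Rightarrow> (bit vec \<Rightarrow> nat) \<Rightarrow> bool" where
  "indistinguishable m k \<phi> \<psi> \<longleftrightarrow>
     (\<forall>i\<le>k. \<forall>s. length s = i \<and> set s \<subseteq> carrier_vec m \<longrightarrow> deck m i \<phi> s = deck m i \<psi> s)"

abbreviation distinguishable ::
    "nat \<Rightarrow> nat \<Rightarrow> (bit vec \<Rightarrow> nat) \<Rightarrow> (bit vec \<Rightarrow> nat) \<Rightarrow> bool" where
  "distinguishable m k \<phi> \<psi> \<equiv> \<not> indistinguishable m k \<phi> \<psi>"

abbreviation Z2_linear :: "nat \<Rightarrow> nat \<Rightarrow> (bit vec \<Rightarrow> bit vec) \<Rightarrow> bool" where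
  "Z2_linear n p \<theta> \<equiv>
     linear_map (class_ring :: bit ring) (module_vec TYPE(bit) n) (module_vec TYPE(bit) p) \<theta>"

definition push :: "nat \<Rightarrow> (bit vec \<Rightarrow> bit vec) \<Rightarrow> (bit vec \<Rightarrow> nat) \<Rightarrow> bit vec \<Rightarrow> nat" where
  "push n \<theta> f x = (\<Sum>z\<in>{z \<in> carrier_vec n. \<theta> z = x}. f z)"

text \<open>
  The index sets of the sums above are finite, so no sum takes the default value 0.
\<close>

lemma finite_carrier_vec_bit: "finite (carrier_vec m :: bit vec set)"
proof -
  have fin: "finite (UNIV :: bit set)"
    by (rule finite_subset[of _ "{0, 1}"]) (auto intro: bit_not_one_iff[THEN iffD1])
  have "carrier_vec m \<subseteq> vec_of_list ` {xs :: bit list. set xs \<subseteq> UNIV \<and> length xs = m}"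
  proof
    fix v :: "bit vec" assume "v \<in> carrier_vec m"
    then have "v = vec_of_list (list_of_vec v)" "length (list_of_vec v) = m"
      by (auto simp: vec_list)
    then show "v \<in> vec_of_list ` {xs. set xs \<subseteq> UNIV \<and> length xs = m}" by blast
  qed
  then show ?thesis
    using finite_lists_length_eq[OF fin] by (rule finite_subset[OF _ finite_imageI])
qed

lemma Z2_linear_iff:
  "Z2_linear n p \<theta> \<longleftrightarrow>
     \<theta> \<in> carrier_vec n \<rightarrow> carrier_vec p \<and>
     (\<forall>u\<in>carrier_vec n. \<forall>v\<in>carrier_vec n. \<theta> (u + v) = \<theta> u + \<theta> v) \<and>
     (\<forall>c. \<forall>v\<in>carrier_vec n. \<theta> (c \<cdot>\<^sub>v v) = c \<cdot>\<^sub>v \<theta> v)"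
proof -
  have vs: "vectorspace (class_ring :: bit ring) (module_vec TYPE(bit) m)" for m
    by (rule vec_vs)
  then have "module (class_ring :: bit ring) (module_vec TYPE(bit) m)" for m
    by (simp add: vectorspace_def)
  with vs show ?thesis
    by (auto simp: linear_map_def mod_hom_def mod_hom_axioms_def LinearCombinations.module_hom_def
        module_vec_simps class_ring_simps)
qed

end

theory Submission
  imports Defs
begin

text \<open>
  For a character \<open>c : \<int>\<^sub>2\<^sup>m \<rightarrow> {1, -1}\<close> let \<open>F f c = \<Sum>x. f x * c x\<close>. Up to a nonzero factor, the
  Fourier coefficient of the \<open>i\<close>-deck of \<open>f\<close> at \<open>(c\<^sub>1, \<dots>, c\<^sub>i)\<close> is \<open>F f c\<^sub>1 \<cdots> F f c\<^sub>i\<close> if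
  \<open>c\<^sub>1 \<cdots> c\<^sub>i = 1\<close>, and it vanishes otherwise. So two multisets are \<open>k\<close>-indistinguishable iff these
  products agree for all tuples of at most \<open>k\<close> characters with product 1. Since
  \<open>F (\<theta> f) c = F f (c \<circ> \<theta>)\<close>, pulling back characters gives (1). For (2), a tuple of characters with
  product 1 that separates \<open>f\<close> from \<open>g\<close> is determined by its first \<open>i - 1 \<le> k - 1\<close> members, and these
  are the coordinates of the required \<open>\<theta>\<close>.
\<close>

section \<open>Characters with values 1 and -1, and their orthogonality\<close>

definition character :: "nat \<Rightarrow> (bit vec \<Rightarrow> int) \<Rightarrow> bool" where
  "character m c \<longleftrightarrow>
     (\<forall>x\<in>carrier_vec m. c x = 1 \<or> c x = -1) \<and>
     (\<forall>x\<in>carrier_vec m. \<forall>y\<in>carrier_vec m. c (x + y) = c x * c y)"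

text \<open>Integers suffice as values: in an elementary abelian 2-group every element is its own
  inverse, so all complex characters take only the values 1 and -1.\<close>

definition fourier :: "nat \<Rightarrow> (bit vec \<Rightarrow> nat) \<Rightarrow> (bit vec \<Rightarrow> int) \<Rightarrow> int" where
  "fourier m f c = (\<Sum>x\<in>carrier_vec m. int (f x) * c x)"

text \<open>The sign (-1)^b, that is, the isomorphism from the additive group of bits to {1,
  -1}.\<close>

definition bit_sign :: "bit \<Rightarrow> int" where
  "bit_sign b = (if b = 0 then 1 else -1)"

lemma bit_sign_add: "bit_sign (a + b) = bit_sign a * bit_sign b"
  by (cases a; cases b) (auto simp: bit_sign_def)

lemma bit_sign_scalar_prod_add:
  assumes "r \<in> carrier_vec m" "x \<in> carrier_vec m" "y \<in> carrier_vec m"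
  shows "bit_sign (r \<bullet> (x + y)) = bit_sign (r \<bullet> x) * bit_sign (r \<bullet> y)"
  by (simp only: scalar_prod_add_distrib[OF assms] bit_sign_add)

lemma add_self_bit_vec:
  fixes x :: "bit vec"
  assumes "x \<in> carrier_vec m"
  shows "x + x = 0\<^sub>v m"
  using assms by (intro eq_vecI) auto

lemma add_add_self_bit_vec:
  fixes x a :: "bit vec"
  assumes "x \<in> carrier_vec m" "a \<in> carrier_vec m"
  shows "x + a + a = x"
  using assms by (simp add: assoc_add_vec[of _ m] add_self_bit_vec)

lemma sum_carrier_shift:
  fixes h :: "bit vec \<Rightarrow> 'a :: comm_monoid_add"
  assumes "a \<in> carrier_vec m"
  shows "(\<Sum>x\<in>carrier_vec m. h (x + a)) = (\<Sum>x\<in>carrier_vec m. h x)"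
  by (rule sum.reindex_bij_witness[where i = "\<lambda>x. x + a" and j = "\<lambda>x. x + a"])
     (use assms in \<open>auto simp: add_add_self_bit_vec\<close>)

lemma character_bit_sign_index:
  "j < m \<Longrightarrow> character m (\<lambda>x. bit_sign (x $ j))"
  by (auto simp: character_def bit_sign_def)

lemma character_bit_sign_scalar_prod:
  assumes "r \<in> carrier_vec m"
  shows "character m (\<lambda>x. bit_sign (r \<bullet> x))"
  using assms by (auto simp: character_def bit_sign_def scalar_prod_add_distrib)

lemma character_prod:
  assumes "finite J" "\<And>j. j \<in> J \<Longrightarrow> character m (c j)"
  shows "character m (\<lambda>x. \<Prod>j\<in>J. c j x)"
  using assms
proof (induction J rule: finite_induct)
  case (insert a J)
  then have "character m (c a)" "character m (\<lambda>x. \<Prod>j\<in>J. c j x)" by auto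
  with insert show ?case
    unfolding character_def by (simp add: mult_ac) fastforce
qed (auto simp: character_def)

lemma character_comp:
  assumes "Z2_linear n p \<theta>" "character p c"
  shows "character n (\<lambda>x. c (\<theta> x))"
  using assms unfolding Z2_linear_iff character_def by (auto simp: Pi_iff)

text \<open>Translating the summation variable by a point where \<open>c\<close> is -1 negates the
  sum, which must therefore be 0.\<close>

lemma sum_character:
  assumes "character m c"
  shows "(\<Sum>x\<in>carrier_vec m. c x) =
    (if \<forall>x\<in>carrier_vec m. c x = 1 then int (card (carrier_vec m :: bit vec set)) else 0)"
proof (cases "\<forall>x\<in>carrier_vec m. c x = 1")
  case False
  then obtain a where a: "a \<in> carrier_vec m" "c a = -1"
    using assms by (auto simp: character_def)
  have "(\<Sum>x\<in>carrier_vec m. c x) = (\<Sum>x\<in>carrier_vec m. c (x + a))"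
    by (rule sum_carrier_shift[OF a(1), symmetric])
  also have "\<dots> = (\<Sum>x\<in>carrier_vec m. - c x)"
    using assms a by (intro sum.cong) (auto simp: character_def)
  finally show ?thesis using False by (auto simp: sum_negf)
qed simp

section \<open>Fourier inversion and push-forward\<close>

lemma card_carrier_vec_bit_pos: "card (carrier_vec m :: bit vec set) > 0"
  using finite_carrier_vec_bit[of m] zero_carrier_vec[of m] card_gt_0_iff by blast

text \<open>The dual orthogonality relation, summing over characters instead of points. Symmetry of
  the scalar product makes it an instance of \<open>sum_character\<close>.\<close>

lemma sum_bit_sign_scalar_prod:
  assumes "x \<in> carrier_vec m"
  shows "(\<Sum>r\<in>carrier_vec m. bit_sign (r \<bullet> x)) =
    (if x = 0\<^sub>v m then int (card (carrier_vec m :: bit vec set)) else 0)"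
proof -
  have *: "(\<Sum>r\<in>carrier_vec m. bit_sign (r \<bullet> x)) = (\<Sum>r\<in>carrier_vec m. bit_sign (x \<bullet> r))"
    using assms by (intro sum.cong) (auto simp: comm_scalar_prod[of _ m])
  have "(\<forall>r\<in>carrier_vec m. bit_sign (x \<bullet> r) = 1) \<longleftrightarrow> x = 0\<^sub>v m"
  proof
    assume all: "\<forall>r\<in>carrier_vec m. bit_sign (x \<bullet> r) = 1"
    show "x = 0\<^sub>v m"
    proof (rule eq_vecI)
      \<comment> \<open>Unit vectors read off the coordinates of \<open>x\<close>, so only the zero
        vector gives the trivial character.\<close>
      fix j assume j: "j < dim_vec (0\<^sub>v m :: bit vec)"
      then have "bit_sign (x \<bullet> unit_vec m j) = 1" using all unit_vec_carrier by blast
      then show "x $ j = 0\<^sub>v m $ j"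
        using j assms by (auto simp: bit_sign_def scalar_prod_right_unit split: if_splits)
    qed (use assms in auto)
  qed (auto simp: bit_sign_def)
  then show ?thesis
    using sum_character[OF character_bit_sign_scalar_prod[OF assms]] * by simp
qed

text \<open>After the two sums are swapped, the inner sum over \<open>r\<close> detects
  \<open>y + x = 0\<close>, which in characteristic 2 means \<open>y = x\<close>. Keeping the group
  order as a factor avoids division in the integers.\<close>

lemma fourier_inversion:
  assumes "x \<in> carrier_vec m"
  shows "(\<Sum>r\<in>carrier_vec m. fourier m f (\<lambda>y. bit_sign (r \<bullet> y)) * bit_sign (r \<bullet> x)) =
    int (card (carrier_vec m :: bit vec set)) * int (f x)"
proof -
  have "(\<Sum>r\<in>carrier_vec m. fourier m f (\<lambda>y. bit_sign (r \<bullet> y)) * bit_sign (r \<bullet> x)) =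
    (\<Sum>r\<in>carrier_vec m. \<Sum>y\<in>carrier_vec m. int (f y) * bit_sign (r \<bullet> (y + x)))"
    using assms
    by (auto simp: fourier_def sum_distrib_right bit_sign_scalar_prod_add[of _ m] mult.assoc
        intro!: sum.cong)
  also have "\<dots> = (\<Sum>y\<in>carrier_vec m. int (f y) * (\<Sum>r\<in>carrier_vec m. bit_sign (r \<bullet> (y + x))))"
    by (subst sum.swap) (simp add: sum_distrib_left)
  also have "\<dots> = (\<Sum>y\<in>carrier_vec m.
      if y = x then int (card (carrier_vec m :: bit vec set)) * int (f x) else 0)"
  proof (rule sum.cong)
    fix y :: "bit vec" assume y: "y \<in> carrier_vec m"
    have "y + x = 0\<^sub>v m \<longleftrightarrow> y = x"
      using assms y add_self_bit_vec add_add_self_bit_vec[OF y assms] by (metis left_zero_vec)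
    then show "int (f y) * (\<Sum>r\<in>carrier_vec m. bit_sign (r \<bullet> (y + x))) =
      (if y = x then int (card (carrier_vec m :: bit vec set)) * int (f x) else 0)"
      using sum_bit_sign_scalar_prod[of "y + x" m] assms y by simp
  qed simp
  finally show ?thesis using assms finite_carrier_vec_bit[of m] by simp
qed

text \<open>The fibres of \<open>\<theta>\<close> partition the domain, so push-forward of multisets
  is adjoint to pull-back of characters.\<close>

lemma fourier_push:
  assumes "Z2_linear n p \<theta>"
  shows "fourier p (push n \<theta> f) c = fourier n f (\<lambda>x. c (\<theta> x))"
proof -
  have maps: "\<theta> ` carrier_vec n \<subseteq> carrier_vec p"
    using assms unfolding Z2_linear_iff by auto
  have "fourier p (push n \<theta> f) c =
    (\<Sum>y\<in>carrier_vec p. \<Sum>z\<in>{z \<in> carrier_vec n. \<theta> z = y}. int (f z) * c (\<theta> z))"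
    unfolding fourier_def push_def by (auto simp: sum_distrib_right intro!: sum.cong)
  also have "\<dots> = fourier n f (\<lambda>x. c (\<theta> x))"
    unfolding fourier_def
    by (rule sum.group[OF finite_carrier_vec_bit finite_carrier_vec_bit maps])
  finally show ?thesis .
qed

section \<open>Decks expressed through products of Fourier coefficients\<close>

lemma indistinguishable_iff_fun:
  "indistinguishable m k f g \<longleftrightarrow>
    (\<forall>i\<le>k. \<forall>s\<in>{..<i} \<rightarrow> carrier_vec m.
      (\<Sum>x\<in>carrier_vec m. \<Prod>j<i. f (x + s j)) = (\<Sum>x\<in>carrier_vec m. \<Prod>j<i. g (x + s j)))"
  (is "_ \<longleftrightarrow> (\<forall>i\<le>k. \<forall>s\<in>_. ?D f i s = ?D g i s)")
proof -
  \<comment> \<open>Tuples become functions here, so that later sums over all tuples factor by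
    \<open>prod_sum_PiE\<close>.\<close>
  have map: "deck m i h (map s [0..<i]) = ?D h i s" for h i and s :: "nat \<Rightarrow> bit vec"
    unfolding deck_def by (intro sum.cong prod.cong) auto
  have nth: "deck m i h s = ?D h i (\<lambda>j. s ! j)" for h i and s :: "bit vec list"
    unfolding deck_def ..
  show ?thesis
  proof (intro iffI allI impI ballI)
    fix i and s :: "nat \<Rightarrow> bit vec"
    assume "indistinguishable m k f g" "i \<le> k" "s \<in> {..<i} \<rightarrow> carrier_vec m"
    moreover from this have "set (map s [0..<i]) \<subseteq> carrier_vec m" by auto
    moreover have "length (map s [0..<i]) = i" by simp
    ultimately have "deck m i f (map s [0..<i]) = deck m i g (map s [0..<i])"
      unfolding indistinguishable_def by blast
    then show "?D f i s = ?D g i s" by (simp only: map)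
  next
    assume *: "\<forall>i\<le>k. \<forall>s\<in>{..<i} \<rightarrow> carrier_vec m. ?D f i s = ?D g i s"
    show "indistinguishable m k f g"
      unfolding indistinguishable_def nth
    proof (intro allI impI)
      fix i and s :: "bit vec list"
      assume i: "i \<le> k" and "length s = i \<and> set s \<subseteq> carrier_vec m"
      then have "(\<lambda>j. s ! j) \<in> {..<i} \<rightarrow> carrier_vec m" using nth_mem by fastforce
      with * i show "?D f i (\<lambda>j. s ! j) = ?D g i (\<lambda>j. s ! j)" by blast
    qed
  qed
qed

text \<open>For fixed \<open>x\<close> the sum over tuples factors into one sum per entry, and
  translating by \<open>x\<close> pulls \<open>c j x\<close> out of each. The sum of these factors
  over \<open>x\<close> is then common to all \<open>f\<close>.\<close>

lemma fourier_deck: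
  fixes i :: nat
  assumes c: "\<And>j. j < i \<Longrightarrow> character m (c j)"
  shows "(\<Sum>s\<in>{..<i} \<rightarrow>\<^sub>E carrier_vec m.
      int (\<Sum>x\<in>carrier_vec m. \<Prod>j<i. f (x + s j)) * (\<Prod>j<i. c j (s j))) =
    (\<Sum>x\<in>carrier_vec m. \<Prod>j<i. c j x) * (\<Prod>j<i. fourier m f (c j))"
proof -
  have shift: "(\<Sum>y\<in>carrier_vec m. int (f (x + y)) * c j y) = c j x * fourier m f (c j)"
    if "j < i" and x: "x \<in> carrier_vec m" for j x
  proof -
    \<comment> \<open>Writing \<open>y\<close> as \<open>y + x + x\<close> turns the summand into a
      function of \<open>y + x\<close>, ready for \<open>sum_carrier_shift\<close>.\<close>
    have "(\<Sum>y\<in>carrier_vec m. int (f (x + y)) * c j y) =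
      (\<Sum>y\<in>carrier_vec m. int (f (y + x)) * c j (y + x + x))"
    proof (rule sum.cong)
      fix y :: "bit vec" assume y: "y \<in> carrier_vec m"
      show "int (f (x + y)) * c j y = int (f (y + x)) * c j (y + x + x)"
        by (simp only: add_add_self_bit_vec[OF y x] comm_add_vec[OF x y])
    qed simp
    also have "\<dots> = (\<Sum>y\<in>carrier_vec m. int (f y) * c j (y + x))"
      by (rule sum_carrier_shift[OF x])
    also have "\<dots> = c j x * fourier m f (c j)"
      unfolding fourier_def sum_distrib_left
      using c[OF \<open>j < i\<close>] x by (intro sum.cong) (auto simp: character_def)
    finally show ?thesis .
  qed
  have "(\<Sum>s\<in>{..<i} \<rightarrow>\<^sub>E carrier_vec m.
      int (\<Sum>x\<in>carrier_vec m. \<Prod>j<i. f (x + s j)) * (\<Prod>j<i. c j (s j))) =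
    (\<Sum>x\<in>carrier_vec m. \<Sum>s\<in>{..<i} \<rightarrow>\<^sub>E carrier_vec m. \<Prod>j<i. int (f (x + s j)) * c j (s j))"
    by (subst sum.swap) (simp add: sum_distrib_right prod.distrib)
  also have "\<dots> = (\<Sum>x\<in>carrier_vec m. \<Prod>j<i. \<Sum>y\<in>carrier_vec m. int (f (x + y)) * c j y)"
    by (intro sum.cong refl prod_sum_PiE[symmetric]) (auto simp: finite_carrier_vec_bit)
  also have "\<dots> = (\<Sum>x\<in>carrier_vec m. \<Prod>j<i. c j x * fourier m f (c j))"
    using shift by (intro sum.cong prod.cong) auto
  finally show ?thesis by (simp add: prod.distrib sum_distrib_right)
qed

text \<open>Each of the \<open>i\<close> factors is expanded by \<open>fourier_inversion\<close>, at
  the cost of one group order each, and the product of sums is multiplied out. The sum over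
  \<open>x\<close> on the right singles out the tuples of characters with product 1.\<close>

lemma deck_fourier_inversion:
  assumes s: "s \<in> {..<i} \<rightarrow> carrier_vec m"
  shows "int (card (carrier_vec m :: bit vec set)) ^ i *
      int (\<Sum>x\<in>carrier_vec m. \<Prod>j<i. f (x + s j)) =
    (\<Sum>r\<in>{..<i} \<rightarrow>\<^sub>E carrier_vec m. (\<Prod>j<i. fourier m f (\<lambda>y. bit_sign (r j \<bullet> y))) *
      ((\<Prod>j<i. bit_sign (r j \<bullet> s j)) * (\<Sum>x\<in>carrier_vec m. \<Prod>j<i. bit_sign (r j \<bullet> x))))"
proof -
  have "int (card (carrier_vec m :: bit vec set)) ^ i *
      int (\<Sum>x\<in>carrier_vec m. \<Prod>j<i. f (x + s j)) =
    (\<Sum>x\<in>carrier_vec m. \<Prod>j<i. int (card (carrier_vec m :: bit vec set)) * int (f (x + s j)))"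
    by (simp add: sum_distrib_left prod.distrib)
  also have "\<dots> = (\<Sum>x\<in>carrier_vec m. \<Prod>j<i. \<Sum>r\<in>carrier_vec m.
      fourier m f (\<lambda>y. bit_sign (r \<bullet> y)) * bit_sign (r \<bullet> (x + s j)))"
    using s by (intro sum.cong prod.cong refl fourier_inversion[symmetric]) (auto simp: Pi_iff)
  also have "\<dots> = (\<Sum>x\<in>carrier_vec m. \<Sum>r\<in>{..<i} \<rightarrow>\<^sub>E carrier_vec m. \<Prod>j<i.
      fourier m f (\<lambda>y. bit_sign (r j \<bullet> y)) * bit_sign (r j \<bullet> (x + s j)))"
    by (intro sum.cong refl prod_sum_PiE) (auto simp: finite_carrier_vec_bit)
  also have "\<dots> = (\<Sum>x\<in>carrier_vec m. \<Sum>r\<in>{..<i} \<rightarrow>\<^sub>E carrier_vec m. \<Prod>j<i.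
      fourier m f (\<lambda>y. bit_sign (r j \<bullet> y)) * (bit_sign (r j \<bullet> s j) * bit_sign (r j \<bullet> x)))"
  proof (intro sum.cong prod.cong refl)
    fix x :: "bit vec" and r :: "nat \<Rightarrow> bit vec" and j
    assume "x \<in> carrier_vec m" "r \<in> {..<i} \<rightarrow>\<^sub>E carrier_vec m" "j \<in> {..<i}"
    moreover from this s have "r j \<in> carrier_vec m" "s j \<in> carrier_vec m" by auto
    ultimately show "fourier m f (\<lambda>y. bit_sign (r j \<bullet> y)) * bit_sign (r j \<bullet> (x + s j)) =
      fourier m f (\<lambda>y. bit_sign (r j \<bullet> y)) * (bit_sign (r j \<bullet> s j) * bit_sign (r j \<bullet> x))"
      by (simp add: bit_sign_scalar_prod_add[of _ m])
  qed
  finally show ?thesis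
    by (subst (asm) sum.swap) (simp add: prod.distrib sum_distrib_left)
qed

lemma indistinguishable_iff_fourier:
  "indistinguishable m k f g \<longleftrightarrow>
    (\<forall>i\<le>k. \<forall>c. (\<forall>j<i. character m (c j)) \<and> (\<forall>x\<in>carrier_vec m. (\<Prod>j<i. c j x) = 1) \<longrightarrow>
      (\<Prod>j<i. fourier m f (c j)) = (\<Prod>j<i. fourier m g (c j)))"
  (is "_ \<longleftrightarrow> ?R")
proof
  assume ind: "indistinguishable m k f g"
  show ?R
  proof (intro allI impI, elim conjE)
    fix i and c :: "nat \<Rightarrow> bit vec \<Rightarrow> int"
    assume i: "i \<le> k" and c: "\<forall>j<i. character m (c j)"
      and one: "\<forall>x\<in>carrier_vec m. (\<Prod>j<i. c j x) = 1"
    have "(\<Sum>x\<in>carrier_vec m. \<Prod>j<i. c j x) * (\<Prod>j<i. fourier m f (c j)) =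
      (\<Sum>x\<in>carrier_vec m. \<Prod>j<i. c j x) * (\<Prod>j<i. fourier m g (c j))"
    proof -
      have "int (\<Sum>x\<in>carrier_vec m. \<Prod>j<i. f (x + s j)) =
        int (\<Sum>x\<in>carrier_vec m. \<Prod>j<i. g (x + s j))" if "s \<in> {..<i} \<rightarrow>\<^sub>E carrier_vec m" for s
        using that ind i unfolding indistinguishable_iff_fun by (simp add: PiE_def)
      then show ?thesis
        using c by (simp add: fourier_deck[symmetric] cong: sum.cong)
    qed
    \<comment> \<open>As the characters have product 1, the common factor is the group order, which
      is positive and cancels.\<close>
    then show "(\<Prod>j<i. fourier m f (c j)) = (\<Prod>j<i. fourier m g (c j))"
      using one card_carrier_vec_bit_pos[of m] by simp
  qed
next
  assume R: ?R
  show "indistinguishable m k f g"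
    unfolding indistinguishable_iff_fun
  proof (intro allI impI ballI)
    fix i and s :: "nat \<Rightarrow> bit vec"
    assume i: "i \<le> k" and s: "s \<in> {..<i} \<rightarrow> carrier_vec m"
    have eq: "(\<Prod>j<i. fourier m f (\<lambda>y. bit_sign (r j \<bullet> y))) *
        ((\<Prod>j<i. bit_sign (r j \<bullet> s j)) * (\<Sum>x\<in>carrier_vec m. \<Prod>j<i. bit_sign (r j \<bullet> x))) =
      (\<Prod>j<i. fourier m g (\<lambda>y. bit_sign (r j \<bullet> y))) *
        ((\<Prod>j<i. bit_sign (r j \<bullet> s j)) * (\<Sum>x\<in>carrier_vec m. \<Prod>j<i. bit_sign (r j \<bullet> x)))"
      if r: "r \<in> {..<i} \<rightarrow>\<^sub>E carrier_vec m" for r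
    proof -
      have c: "character m (\<lambda>y. bit_sign (r j \<bullet> y))" if "j < i" for j
        using r that by (intro character_bit_sign_scalar_prod) auto
      then have prod: "character m (\<lambda>x. \<Prod>j<i. bit_sign (r j \<bullet> x))"
        by (intro character_prod) auto
      \<comment> \<open>If the characters have product 1, the hypothesis \<open>?R\<close> applies;
        otherwise orthogonality makes both sides 0.\<close>
      show ?thesis
      proof (cases "\<forall>x\<in>carrier_vec m. (\<Prod>j<i. bit_sign (r j \<bullet> x)) = 1")
        case True
        then have "(\<Prod>j<i. fourier m f (\<lambda>y. bit_sign (r j \<bullet> y))) =
          (\<Prod>j<i. fourier m g (\<lambda>y. bit_sign (r j \<bullet> y)))"
          using R[rule_format, of i "\<lambda>j y. bit_sign (r j \<bullet> y)"] c i by blast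
        then show ?thesis by simp
      next
        case False
        then have "(\<Sum>x\<in>carrier_vec m. \<Prod>j<i. bit_sign (r j \<bullet> x)) = 0"
          by (subst sum_character[OF prod]) (rule if_not_P)
        then show ?thesis by simp
      qed
    qed
    have "int (card (carrier_vec m :: bit vec set)) ^ i *
        int (\<Sum>x\<in>carrier_vec m. \<Prod>j<i. f (x + s j)) =
      int (card (carrier_vec m :: bit vec set)) ^ i *
        int (\<Sum>x\<in>carrier_vec m. \<Prod>j<i. g (x + s j))"
      unfolding deck_fourier_inversion[OF s] by (rule sum.cong[OF refl eq])
    then show "(\<Sum>x\<in>carrier_vec m. \<Prod>j<i. f (x + s j)) = (\<Sum>x\<in>carrier_vec m. \<Prod>j<i. g (x + s j))"
      using card_carrier_vec_bit_pos[of m] by (simp del: of_nat_sum)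
  qed
qed

section \<open>Transfer along linear maps\<close>

lemma indistinguishable_push:
  assumes "Z2_linear n p \<theta>" "indistinguishable n k f g"
  shows "indistinguishable p k (push n \<theta> f) (push n \<theta> g)"
  unfolding indistinguishable_iff_fourier fourier_push[OF assms(1)]
proof (intro allI impI, elim conjE)
  fix i and c :: "nat \<Rightarrow> bit vec \<Rightarrow> int"
  assume i: "i \<le> k" and c: "\<forall>j<i. character p (c j)"
    and one: "\<forall>x\<in>carrier_vec p. (\<Prod>j<i. c j x) = 1"
  \<comment> \<open>Pulling back along \<open>\<theta>\<close> preserves both conditions on the
    tuple: being characters and having product 1.\<close>
  have "\<forall>j<i. character n (\<lambda>x. c j (\<theta> x))"
    using c character_comp[OF assms(1)] by blast
  moreover have "\<forall>x\<in>carrier_vec n. (\<Prod>j<i. c j (\<theta> x)) = 1"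
    using one assms(1) unfolding Z2_linear_iff by auto
  ultimately show "(\<Prod>j<i. fourier n f (\<lambda>x. c j (\<theta> x))) = (\<Prod>j<i. fourier n g (\<lambda>x. c j (\<theta> x)))"
    using assms(2)[unfolded indistinguishable_iff_fourier, rule_format, of i "\<lambda>j x. c j (\<theta> x)"] i
    by blast
qed

text \<open>Undoing \<open>bit_sign\<close> coordinatewise turns multiplicative characters into
  additive bit-valued maps, the coordinates of \<open>\<theta>\<close>.\<close>

lemma Z2_linear_of_characters:
  assumes "\<And>j. j < p \<Longrightarrow> character n (c j)"
  obtains \<theta> where "Z2_linear n p \<theta>"
    "\<And>x j. x \<in> carrier_vec n \<Longrightarrow> j < p \<Longrightarrow> bit_sign (\<theta> x $ j) = c j x"
proof
  define \<theta> :: "bit vec \<Rightarrow> bit vec" where "\<theta> x = vec p (\<lambda>j. if c j x = 1 then 0 else 1)" for x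
  have val: "c j x = 1 \<or> c j x = -1" if "x \<in> carrier_vec n" "j < p" for x j
    using assms[OF that(2)] that(1) by (auto simp: character_def)
  have mult: "c j (x + y) = c j x * c j y"
    if "x \<in> carrier_vec n" "y \<in> carrier_vec n" "j < p" for x y j
    using assms[OF that(3)] that by (auto simp: character_def)
  have add: "\<theta> (x + y) = \<theta> x + \<theta> y" if "x \<in> carrier_vec n" "y \<in> carrier_vec n" for x y
  proof (rule eq_vecI)
    fix j assume "j < dim_vec (\<theta> x + \<theta> y)"
    then have "j < p" by (simp add: \<theta>_def)
    with val[of x j] val[of y j] mult[of x y j] that show "\<theta> (x + y) $ j = (\<theta> x + \<theta> y) $ j"
      by (auto simp: \<theta>_def)
  qed (simp add: \<theta>_def)
  have zero: "\<theta> (0\<^sub>v n) = 0\<^sub>v p"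
    using add[of "0\<^sub>v n" "0\<^sub>v n"] add_self_bit_vec[of "\<theta> (0\<^sub>v n)" p] by (simp add: \<theta>_def)
  \<comment> \<open>The only scalars are 0 and 1, so additivity already yields linearity.\<close>
  have smult: "\<theta> (a \<cdot>\<^sub>v x) = a \<cdot>\<^sub>v \<theta> x" if "x \<in> carrier_vec n" for a x
  proof (cases a)
    case zero
    have "(0 :: bit) \<cdot>\<^sub>v x = 0\<^sub>v n" using that by (intro eq_vecI) auto
    moreover have "(0 :: bit) \<cdot>\<^sub>v \<theta> x = 0\<^sub>v p" by (intro eq_vecI) (auto simp: \<theta>_def)
    ultimately show ?thesis using \<open>\<theta> (0\<^sub>v n) = 0\<^sub>v p\<close> zero by simp
  qed simp
  show "Z2_linear n p \<theta>"
    unfolding Z2_linear_iff using add smult by (auto simp: \<theta>_def)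
  show "bit_sign (\<theta> x $ j) = c j x" if "x \<in> carrier_vec n" "j < p" for x j
    using val[OF that] that by (auto simp: \<theta>_def bit_sign_def)
qed

lemma distinguishable_push:
  assumes "distinguishable n k f g"
  obtains \<theta> where "Z2_linear n (k - 1) \<theta>" "distinguishable (k - 1) k (push n \<theta> f) (push n \<theta> g)"
proof -
  obtain i c where i: "i \<le> k" and c: "\<And>j. j < i \<Longrightarrow> character n (c j)"
    and one: "\<And>x. x \<in> carrier_vec n \<Longrightarrow> (\<Prod>j<i. c j x) = 1"
    and ne: "(\<Prod>j<i. fourier n f (c j)) \<noteq> (\<Prod>j<i. fourier n g (c j))"
    using assms unfolding indistinguishable_iff_fourier by blast
  \<comment> \<open>For \<open>i = 0\<close> both products are empty and equal, so a last character
    exists and only \<open>l \<le> k - 1\<close> others remain.\<close>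
  from ne obtain l where l: "i = Suc l" by (cases i) auto
  define c' where "c' j = (if j < l then c j else (\<lambda>_. 1))" for j
  have "character n (c' j)" for j
    using c l by (auto simp: c'_def character_def)
  then obtain \<theta> where lin: "Z2_linear n (k - 1) \<theta>"
    and \<theta>: "\<And>x j. x \<in> carrier_vec n \<Longrightarrow> j < k - 1 \<Longrightarrow> bit_sign (\<theta> x $ j) = c' j x"
    using Z2_linear_of_characters[of "k - 1" n c'] by blast
  \<comment> \<open>The tuple on the target: coordinate characters for the first \<open>l\<close>
    places, and in place \<open>l\<close> their product, which forces the whole tuple to have
    product 1.\<close>
  define d where
    "d j = (\<lambda>y. if j < l then bit_sign (y $ j) else (\<Prod>t<l. bit_sign (y $ t)))" for j
  have lk: "t < k - 1" if "t < l" for t using that i l by simp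
  have sq: "P * P = 1" if "character n e" "x \<in> carrier_vec n" "P = e x" for n e x and P :: int
    using that by (auto simp: character_def)
  have d: "character (k - 1) (d j)" for j
  proof (cases "j < l")
    case True
    then show ?thesis using character_bit_sign_index[OF lk[OF True]] by (simp add: d_def)
  next
    case False
    then show ?thesis
      using character_prod[of "{..<l}" "k - 1" "\<lambda>t y. bit_sign (y $ t)"] character_bit_sign_index lk
      by (simp add: d_def)
  qed
  have d_one: "(\<Prod>j<i. d j y) = 1" if "y \<in> carrier_vec (k - 1)" for y
    \<comment> \<open>The total product is the square of the value of \<open>d l\<close>, a
      sign.\<close>
    using sq[OF d[of l] that refl] by (simp add: l d_def)
  have d\<theta>: "d j (\<theta> x) = c j x" if "x \<in> carrier_vec n" "j < i" for x j
  proof (cases "j < l")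
    case True
    then show ?thesis using \<theta>[OF that(1) lk[OF True]] by (simp add: d_def c'_def)
  next
    case False
    then have j: "j = l" using that l by simp
    have "d l (\<theta> x) = (\<Prod>t<l. c t x)"
      using \<theta>[OF that(1) lk] by (simp add: d_def c'_def)
    \<comment> \<open>A sign is its own inverse, so product 1 identifies \<open>c l x\<close> with
      the product of the other characters at \<open>x\<close>.\<close>
    moreover have "(\<Prod>t<l. c t x) * c l x = 1" using one[OF that(1)] l by simp
    moreover have "c l x = 1 \<or> c l x = -1"
      using c[of l] l that(1) by (auto simp: character_def)
    ultimately show ?thesis using j by auto
  qed
  have "fourier (k - 1) (push n \<theta> h) (d j) = fourier n h (c j)" if "j < i" for h j
    unfolding fourier_push[OF lin] using d\<theta>[OF _ that] by (simp add: fourier_def)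
  then have "(\<Prod>j<i. fourier (k - 1) (push n \<theta> f) (d j)) \<noteq>
    (\<Prod>j<i. fourier (k - 1) (push n \<theta> g) (d j))"
    using ne by simp
  then have "distinguishable (k - 1) k (push n \<theta> f) (push n \<theta> g)"
    unfolding indistinguishable_iff_fourier using i d d_one by blast
  with lin show ?thesis by (rule that)
qed

theorem theorem3p4:
  fixes n k :: nat and f g :: "bit vec \<Rightarrow> nat"
  assumes "n \<ge> 1" and "k \<ge> 2"
  shows "(indistinguishable n k f g \<longrightarrow>
            (\<forall>p \<theta>. Z2_linear n p \<theta> \<longrightarrow> indistinguishable p k (push n \<theta> f) (push n \<theta> g)))
       \<and> (distinguishable n k f g \<longrightarrow>
            (\<exists>\<theta>. Z2_linear n (k - 1) \<theta> \<and>
                 distinguishable (k - 1) k (push n \<theta> f) (push n \<theta> g)))"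
  using indistinguishable_push distinguishable_push by metis

end
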